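(* Let $(S,A)$ be a non-negative integer physical model such that $S$ is a recursively enumerable set and each member of $A$ is a partial recursive function whose domain includes all members of $S$. Then $(S,A)$ is isomorphic to some computable physical model.
   Context: A non-negative integer physical model is a pair $(S,A)$ where $S$ is a set of non-negative integers (the states) and each member of $A$ (the observable quantities) is a partial function from the non-negative integers to the non-negative integers. A computable physical model is a pair $(S,A)$ where $S$ is a recursive set of non-negative integers and $A$ is a set of total recursive functions from the non-negative integers to the non-negative integers. Two such models $(S,A)$ and $(T,B)$ are isomorphic iff there exist bijections $\phi:S\to T$ and $\psi:A\to B$ such that $\alpha(s)=\psi(\alpha)(\phi(s))$ for all $s\in S$ and $\alpha\in A$. *)

theory Defs
  imports Main
begin

text \<open>
  A partial function of \<open>k\<close> arguments is represented as a map on lists that is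
  undefined on every list whose length is not \<open>k\<close>.
\<close>

definition zero_fn :: "nat \<Rightarrow> nat list \<rightharpoonup> nat" where
  "zero_fn k xs = (if length xs = k then Some 0 else None)"

definition succ_fn :: "nat list \<rightharpoonup> nat" where
  "succ_fn xs = (if length xs = 1 then Some (Suc (hd xs)) else None)"

definition proj_fn :: "nat \<Rightarrow> nat \<Rightarrow> nat list \<rightharpoonup> nat" where
  "proj_fn k i xs = (if length xs = k then Some (xs ! i) else None)"

text \<open>
  Composition is strict: it is undefined as soon as one of the inner functions is.
\<close>

definition comp_fn ::
  "nat \<Rightarrow> (nat list \<rightharpoonup> nat) \<Rightarrow> (nat list \<rightharpoonup> nat) list \<Rightarrow> nat list \<rightharpoonup> nat" where
  "comp_fn k f gs xs =
     (if length xs = k \<and> (\<forall>g\<in>set gs. g xs \<noteq> None)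
      then f (map (\<lambda>g. the (g xs)) gs) else None)"

text \<open>The recursion variable is the first argument.\<close>

primrec prim_rec_aux ::
  "(nat list \<rightharpoonup> nat) \<Rightarrow> (nat list \<rightharpoonup> nat) \<Rightarrow> nat list \<Rightarrow> nat \<rightharpoonup> nat" where
  "prim_rec_aux f g ys 0 = f ys"
| "prim_rec_aux f g ys (Suc n) =
     (case prim_rec_aux f g ys n of None \<Rightarrow> None | Some r \<Rightarrow> g (n # r # ys))"

definition prim_rec_fn ::
  "(nat list \<rightharpoonup> nat) \<Rightarrow> (nat list \<rightharpoonup> nat) \<Rightarrow> nat list \<rightharpoonup> nat" where
  "prim_rec_fn f g xs = (case xs of [] \<Rightarrow> None | n # ys \<Rightarrow> prim_rec_aux f g ys n)"

text \<open>
  Minimization requires \<open>f\<close> to be defined at all arguments below the zero that is found.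
\<close>

definition mu_fn :: "(nat list \<rightharpoonup> nat) \<Rightarrow> nat list \<rightharpoonup> nat" where
  "mu_fn f xs =
     (if \<exists>n. f (n # xs) = Some 0 \<and> (\<forall>m<n. f (m # xs) \<noteq> None)
      then Some (LEAST n. f (n # xs) = Some 0) else None)"

inductive partial_recursive_n :: "nat \<Rightarrow> (nat list \<rightharpoonup> nat) \<Rightarrow> bool" where
  zero: "partial_recursive_n k (zero_fn k)"
| succ: "partial_recursive_n 1 succ_fn"
| proj: "i < k \<Longrightarrow> partial_recursive_n k (proj_fn k i)"
| comp: "partial_recursive_n (length gs) f \<Longrightarrow> (\<forall>g\<in>set gs. partial_recursive_n k g) \<Longrightarrow>
         partial_recursive_n k (comp_fn k f gs)"
| prim_rec: "partial_recursive_n k f \<Longrightarrow> partial_recursive_n (k + 2) g \<Longrightarrow>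
         partial_recursive_n (k + 1) (prim_rec_fn f g)"
| mu: "partial_recursive_n (k + 1) f \<Longrightarrow> partial_recursive_n k (mu_fn f)"

definition partial_recursive :: "(nat \<rightharpoonup> nat) \<Rightarrow> bool" where
  "partial_recursive f \<longleftrightarrow>
     partial_recursive_n 1 (\<lambda>xs. if length xs = 1 then f (hd xs) else None)"

definition total_recursive :: "(nat \<rightharpoonup> nat) \<Rightarrow> bool" where
  "total_recursive f \<longleftrightarrow> partial_recursive f \<and> dom f = UNIV"

definition recursive_set :: "nat set \<Rightarrow> bool" where
  "recursive_set S \<longleftrightarrow> total_recursive (\<lambda>n. Some (if n \<in> S then 1 else 0))"

definition recursively_enumerable :: "nat set \<Rightarrow> bool" where
  "recursively_enumerable S \<longleftrightarrow> S = {} \<or> (\<exists>f. total_recursive f \<and> S = ran f)"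

text \<open>
  A model consists of a set of states and a set of observable quantities. Every value of
  this type is a non-negative integer physical model.
\<close>

type_synonym nat_model = "nat set \<times> (nat \<rightharpoonup> nat) set"

definition computable_model :: "nat_model \<Rightarrow> bool" where
  "computable_model M \<longleftrightarrow>
     (case M of (S, A) \<Rightarrow> recursive_set S \<and> (\<forall>\<alpha>\<in>A. total_recursive \<alpha>))"

text \<open>
  The equation between partial values below also covers undefinedness: one side is
  undefined iff the other one is.
\<close>

definition isomorphic_models :: "nat_model \<Rightarrow> nat_model \<Rightarrow> bool" where
  "isomorphic_models M N \<longleftrightarrow>
     (case (M, N) of ((S, A), (T, B)) \<Rightarrow>
        \<exists>\<phi> \<psi>. bij_betw \<phi> S T \<and> bij_betw \<psi> A B \<and>
              (\<forall>s\<in>S. \<forall>\<alpha>\<in>A. \<alpha> s = (\<psi> \<alpha>) (\<phi> s)))"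

end

theory Submission
  imports Defs "HOL-Library.Countable_Set"
begin

text \<open>
  Let \<open>h\<close> be a total recursive function with range \<open>S\<close>. The set \<open>T\<close> of those \<open>n\<close> at which
  \<open>h\<close> takes a value for the first time is recursive, and \<open>h\<close> maps \<open>T\<close> bijectively onto \<open>S\<close>,
  so \<open>\<alpha>\<close> can be replaced by \<open>\<alpha> \<circ> h\<close> on \<open>T\<close>. Observables that agree on \<open>S\<close> must still
  be kept apart: if \<open>h\<close> is chosen with \<open>h 1 = h 0\<close>, then \<open>1 \<notin> T\<close>, and since there are only
  countably many partial recursive functions, the constant value given to the new observable
  outside \<open>T\<close> can serve as an index of \<open>\<alpha>\<close>.
\<close>

section \<open>Total recursive functions\<close>

text \<open>This lets total functions be written as plain HOL functions on lists. Values of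
  \<open>F\<close> at lists of the wrong length are arbitrary and are cut off.\<close>

definition total_fn :: "nat \<Rightarrow> (nat list \<Rightarrow> nat) \<Rightarrow> nat list \<rightharpoonup> nat" where
  "total_fn k F xs = (if length xs = k then Some (F xs) else None)"

definition recursive_n :: "nat \<Rightarrow> (nat list \<Rightarrow> nat) \<Rightarrow> bool" where
  "recursive_n k F \<longleftrightarrow> partial_recursive_n k (total_fn k F)"

lemma recursive_n_cong:
  assumes "recursive_n k F" and "\<And>xs. length xs = k \<Longrightarrow> F xs = G xs"
  shows "recursive_n k G"
proof -
  have "total_fn k F = total_fn k G"
    using assms(2) by (auto simp: total_fn_def)
  then show ?thesis
    using assms(1) by (simp add: recursive_n_def)
qed

lemma total_recursive_iff_recursive_n:
  "total_recursive (\<lambda>n. Some (f n)) \<longleftrightarrow> recursive_n 1 (\<lambda>xs. f (xs ! 0))"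
proof -
  have "(\<lambda>xs. if length xs = 1 then Some (f (hd xs)) else None) = total_fn 1 (\<lambda>xs. f (xs ! 0))"
    by (auto simp: fun_eq_iff total_fn_def length_Suc_conv)
  then show ?thesis
    by (auto simp: total_recursive_def partial_recursive_def recursive_n_def dom_def)
qed

section \<open>Initial functions, composition and primitive recursion\<close>

lemma recursive_n_proj: "i < k \<Longrightarrow> recursive_n k (\<lambda>xs. xs ! i)"
proof -
  have "total_fn k (\<lambda>xs. xs ! i) = proj_fn k i"
    by (auto simp: total_fn_def proj_fn_def)
  then show "i < k \<Longrightarrow> ?thesis"
    by (simp add: recursive_n_def partial_recursive_n.proj)
qed

lemma recursive_n_Suc: "recursive_n 1 (\<lambda>xs. Suc (xs ! 0))"
proof -
  have "total_fn 1 (\<lambda>xs. Suc (xs ! 0)) = succ_fn"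
    by (auto simp: fun_eq_iff total_fn_def succ_fn_def length_Suc_conv)
  then show ?thesis
    using partial_recursive_n.succ by (simp add: recursive_n_def)
qed

lemma recursive_n_comp:
  assumes "recursive_n (length Gs) F" and "\<And>G. G \<in> set Gs \<Longrightarrow> recursive_n k G"
  shows "recursive_n k (\<lambda>xs. F (map (\<lambda>G. G xs) Gs))"
proof -
  have "total_fn k (\<lambda>xs. F (map (\<lambda>G. G xs) Gs)) =
      comp_fn k (total_fn (length Gs) F) (map (total_fn k) Gs)"
    by (auto simp: total_fn_def comp_fn_def o_def)
  then show ?thesis
    using assms by (auto simp: recursive_n_def intro!: partial_recursive_n.comp)
qed

lemma recursive_n_comp1:
  assumes "recursive_n 1 (\<lambda>ys. f (ys ! 0))" "recursive_n k F"
  shows "recursive_n k (\<lambda>xs. f (F xs))"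
  using recursive_n_comp[of "[F]" "\<lambda>ys. f (ys ! 0)" k] assms by simp

lemma recursive_n_comp2:
  assumes "recursive_n 2 (\<lambda>ys. f (ys ! 0) (ys ! 1))" "recursive_n k F" "recursive_n k G"
  shows "recursive_n k (\<lambda>xs. f (F xs) (G xs))"
  using recursive_n_comp[of "[F, G]" "\<lambda>ys. f (ys ! 0) (ys ! 1)" k] assms
  by (auto simp: numeral_2_eq_2)

lemma recursive_n_comp3:
  assumes "recursive_n 3 (\<lambda>ys. f (ys ! 0) (ys ! 1) (ys ! 2))"
    and "recursive_n k F" "recursive_n k G" "recursive_n k H"
  shows "recursive_n k (\<lambda>xs. f (F xs) (G xs) (H xs))"
  using recursive_n_comp[of "[F, G, H]" "\<lambda>ys. f (ys ! 0) (ys ! 1) (ys ! 2)" k] assms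
  by (auto simp: numeral_2_eq_2 numeral_3_eq_3)

lemma recursive_n_const: "recursive_n k (\<lambda>_. c)"
proof (induction c)
  case 0
  have "total_fn k (\<lambda>_. 0) = zero_fn k"
    by (auto simp: total_fn_def zero_fn_def)
  then show ?case
    by (simp add: recursive_n_def partial_recursive_n.zero)
next
  case (Suc c)
  then show ?case
    using recursive_n_comp1[OF recursive_n_Suc] by blast
qed

text \<open>With total \<open>F\<close> and \<open>G\<close> the recursion never reaches
  \<open>None\<close> on lists of the right length, so \<open>prim_rec_aux\<close> collapses to
  \<open>rec_nat\<close>.\<close>

lemma recursive_n_prim_rec:
  assumes "recursive_n k F" "recursive_n (Suc (Suc k)) G"
  shows "recursive_n (Suc k) (\<lambda>xs. rec_nat (F (tl xs)) (\<lambda>n r. G (n # r # tl xs)) (hd xs))"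
proof -
  have aux: "prim_rec_aux (total_fn k F) (total_fn (Suc (Suc k)) G) ys n =
      (if length ys = k then Some (rec_nat (F ys) (\<lambda>n r. G (n # r # ys)) n) else None)"
    for ys n
    by (induction n) (auto simp: total_fn_def)
  have "prim_rec_fn (total_fn k F) (total_fn (Suc (Suc k)) G) =
      total_fn (Suc k) (\<lambda>xs. rec_nat (F (tl xs)) (\<lambda>n r. G (n # r # tl xs)) (hd xs))"
    by (rule ext) (auto simp: prim_rec_fn_def aux total_fn_def split: list.splits)
  then show ?thesis
    using assms partial_recursive_n.prim_rec[of k "total_fn k F" "total_fn (Suc (Suc k)) G"]
    by (simp add: recursive_n_def)
qed

section \<open>Truncated subtraction and case distinctions\<close>

lemma recursive_n_pred: "recursive_n 1 (\<lambda>xs. xs ! 0 - 1)"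
proof -
  \<comment> \<open>The step returns the counter \<open>n\<close> and ignores the previous value
    \<open>r\<close>.\<close>
  have "recursive_n (Suc 0) (\<lambda>xs. rec_nat 0 (\<lambda>n r. (n # r # tl xs) ! 0) (hd xs))"
    by (rule recursive_n_prim_rec) (auto intro: recursive_n_const recursive_n_proj)
  moreover have "rec_nat 0 (\<lambda>n r. n) m = m - 1" for m :: nat
    by (cases m) auto
  ultimately show ?thesis
    by (auto elim!: recursive_n_cong simp: length_Suc_conv)
qed

text \<open>Subtraction iterates the predecessor. The recursion runs over the subtrahend, which must
  come first, so the two arguments are swapped at the end.\<close>

lemma recursive_n_diff:
  assumes "recursive_n k F" "recursive_n k G"
  shows "recursive_n k (\<lambda>xs. F xs - G xs)"
proof -
  have "recursive_n (Suc 1)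
      (\<lambda>xs. rec_nat (tl xs ! 0) (\<lambda>n r. (n # r # tl xs) ! 1 - 1) (hd xs))"
    by (rule recursive_n_prim_rec)
      (auto intro: recursive_n_proj recursive_n_comp1[OF recursive_n_pred, unfolded One_nat_def])
  moreover have "rec_nat x (\<lambda>n r. r - 1) m = x - m" for x m :: nat
    by (induction m) auto
  ultimately have "recursive_n 2 (\<lambda>xs. xs ! 1 - xs ! 0)"
    by (auto elim!: recursive_n_cong simp: length_Suc_conv numeral_2_eq_2)
  from recursive_n_comp2[OF this assms(2,1)] show ?thesis .
qed

text \<open>Recursion on the condition: the base case yields the first branch, and every step yields
  the second one, found at position 3 behind counter, previous value and first branch.\<close>

lemma recursive_n_if_zero:
  assumes "recursive_n k C" "recursive_n k F" "recursive_n k G"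
  shows "recursive_n k (\<lambda>xs. if C xs = 0 then F xs else G xs)"
proof -
  have "recursive_n (Suc 2)
      (\<lambda>xs. rec_nat (tl xs ! 0) (\<lambda>n r. (n # r # tl xs) ! 3) (hd xs))"
    by (rule recursive_n_prim_rec) (auto intro: recursive_n_proj)
  moreover have "rec_nat x (\<lambda>n r. y) m = (if m = 0 then x else y)" for x y m :: nat
    by (cases m) auto
  ultimately have "recursive_n 3 (\<lambda>xs. if xs ! 0 = 0 then xs ! 1 else xs ! 2)"
    by (auto elim!: recursive_n_cong simp: length_Suc_conv numeral_2_eq_2 numeral_3_eq_3)
  from recursive_n_comp3[OF this assms] show ?thesis .
qed

text \<open>Two numbers are equal iff both truncated differences vanish.\<close>

lemma recursive_n_if_eq:
  assumes "recursive_n k C" "recursive_n k D" "recursive_n k F" "recursive_n k G"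
  shows "recursive_n k (\<lambda>xs. if C xs = D xs then F xs else G xs)"
proof -
  have "recursive_n k (\<lambda>xs. if C xs - D xs = 0 then if D xs - C xs = 0 then F xs else G xs else G xs)"
    by (intro recursive_n_if_zero recursive_n_diff assms)
  then show ?thesis
    by (rule recursive_n_cong) auto
qed

section \<open>First occurrences and composition with a partial function\<close>

lemma recursive_set_first_occurrences:
  assumes "total_recursive (\<lambda>n. Some (f n))"
  shows "recursive_set {n. \<forall>m<n. f m \<noteq> f n}"
proof -
  have f: "recursive_n k (\<lambda>xs. f (F xs))" if "recursive_n k F" for k F
    using assms that unfolding total_recursive_iff_recursive_n by (rule recursive_n_comp1)
  \<comment> \<open>Bounded search: the flag \<open>r\<close> starts at 1 and drops to 0 for good
    once the value \<open>y\<close> is met.\<close>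
  have aux: "rec_nat 1 (\<lambda>n r. if f n = y then 0 else r) m =
      (if \<forall>j<m. f j \<noteq> y then 1 else 0 :: nat)" for y m
    by (induction m) (auto simp: less_Suc_eq)
  have "recursive_n (Suc 1) (\<lambda>xs. rec_nat 1 (\<lambda>n r.
      (\<lambda>ys. if f (ys ! 0) = f (ys ! 2) then 0 else ys ! 1) (n # r # tl xs)) (hd xs))"
    by (rule recursive_n_prim_rec; intro recursive_n_const recursive_n_if_eq f recursive_n_proj) auto
  then have "recursive_n (Suc 1) (\<lambda>xs. if \<forall>j<xs ! 0. f j \<noteq> f (xs ! 1) then 1 else 0)"
  proof (rule recursive_n_cong)
    fix xs :: "nat list" assume "length xs = Suc 1"
    then obtain m x where "xs = [m, x]"
      by (auto simp: length_Suc_conv)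
    then show "rec_nat 1 (\<lambda>n r. (\<lambda>ys. if f (ys ! 0) = f (ys ! 2) then 0 else ys ! 1)
        (n # r # tl xs)) (hd xs) = (if \<forall>j<xs ! 0. f j \<noteq> f (xs ! 1) then 1 else 0)"
      using aux[of "f x" m] by (simp cong: if_cong)
  qed
  then have "recursive_n 2 (\<lambda>xs. if \<forall>j<xs ! 0. f j \<noteq> f (xs ! 1) then 1 else 0)"
    by (simp add: numeral_2_eq_2)
  \<comment> \<open>On the diagonal the search bound and the argument whose value is sought
    coincide.\<close>
  from recursive_n_comp2[OF this recursive_n_proj recursive_n_proj, of 0 1 0]
  have "recursive_n 1 (\<lambda>xs. if \<forall>j<xs ! 0. f j \<noteq> f (xs ! 0) then 1 else 0)"
    by simp
  then show ?thesis
    by (simp only: recursive_set_def total_recursive_iff_recursive_n mem_Collect_eq)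
qed

text \<open>Since \<open>f\<close> only takes values in the domain of \<open>\<alpha>\<close>,
  strict composition is defined everywhere.\<close>

lemma total_recursive_partial_comp:
  assumes "partial_recursive \<alpha>" "total_recursive (\<lambda>n. Some (f n))" "range f \<subseteq> dom \<alpha>"
  shows "total_recursive (\<lambda>n. Some (the (\<alpha> (f n))))"
proof -
  let ?f = "total_fn 1 (\<lambda>xs. f (xs ! 0))"
  let ?\<alpha> = "\<lambda>xs. if length xs = 1 then \<alpha> (hd xs) else None"
  have "\<alpha> (f n) = Some (the (\<alpha> (f n)))" for n
    using assms(3) by (metis domD option.sel rangeI subsetD)
  then have "total_fn 1 (\<lambda>xs. the (\<alpha> (f (xs ! 0)))) = comp_fn 1 ?\<alpha> [?f]"
    by (auto simp: total_fn_def comp_fn_def)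
  then show ?thesis
    using assms partial_recursive_n.comp[of "[?f]" ?\<alpha> 1]
    by (simp add: total_recursive_iff_recursive_n partial_recursive_def recursive_n_def)
qed

section \<open>Countability\<close>

text \<open>Syntax trees for the generation of partial recursive functions. Arities are not checked:
  for countability it is enough that every partial recursive function has a code.\<close>

datatype rec_code =
  Zero_code nat | Succ_code | Proj_code nat nat | Comp_code nat rec_code "rec_code list"
| Prim_rec_code rec_code rec_code | Mu_code rec_code

instance rec_code :: countable
  by countable_datatype

primrec eval_code :: "rec_code \<Rightarrow> nat list \<rightharpoonup> nat" where
  "eval_code (Zero_code k) = zero_fn k"
| "eval_code Succ_code = succ_fn"
| "eval_code (Proj_code k i) = proj_fn k i"
| "eval_code (Comp_code k c cs) = comp_fn k (eval_code c) (map eval_code cs)"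
| "eval_code (Prim_rec_code c d) = prim_rec_fn (eval_code c) (eval_code d)"
| "eval_code (Mu_code c) = mu_fn (eval_code c)"

lemma partial_recursive_n_imp_code: "partial_recursive_n k f \<Longrightarrow> f \<in> range eval_code"
proof (induction rule: partial_recursive_n.induct)
  case (comp gs f k)
  then have "gs \<in> lists (range eval_code)"
    by auto
  then obtain cs where "gs = map eval_code cs"
    by (auto simp: lists_image)
  with comp show ?case
    by (auto intro: range_eqI[of _ _ "Comp_code _ _ _"])
next
  case (prim_rec k f g)
  then show ?case
    by (auto intro: range_eqI[of _ _ "Prim_rec_code _ _"])
next
  case (mu k f)
  then show ?case
    by (auto intro: range_eqI[of _ _ "Mu_code _"])
qed (auto intro: range_eqI[of _ _ "Zero_code _"] range_eqI[of _ _ Succ_code]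
    range_eqI[of _ _ "Proj_code _ _"])

lemma countable_partial_recursive: "countable {\<alpha>. partial_recursive \<alpha>}"
proof -
  let ?lift = "\<lambda>(\<alpha> :: nat \<rightharpoonup> nat) xs. if length xs = 1 then \<alpha> (hd xs) else None"
  have "inj ?lift"
  \<comment> \<open>A unary function is recovered from its lift at one-element lists.\<close>
  proof (rule injI)
    fix \<alpha> \<beta> assume eq: "?lift \<alpha> = ?lift \<beta>"
    show "\<alpha> = \<beta>"
      using fun_cong[OF eq, of "[n]" for n] by auto
  qed
  moreover have "?lift ` {\<alpha>. partial_recursive \<alpha>} \<subseteq> range eval_code"
    using partial_recursive_n_imp_code by (auto simp: partial_recursive_def)
  then have "countable (?lift ` {\<alpha>. partial_recursive \<alpha>})"
    by (rule countable_subset) simp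
  ultimately show ?thesis
    using countable_image_inj_on inj_on_subset by blast
qed

section \<open>The isomorphic computable model\<close>

text \<open>Of two distinct arguments with equal values the larger is no first occurrence; every
  value is attained first at its least preimage.\<close>

lemma bij_betw_first_occurrences:
  fixes f :: "nat \<Rightarrow> 'a"
  shows "bij_betw f {n. \<forall>m<n. f m \<noteq> f n} (range f)"
  unfolding bij_betw_def
proof (intro conjI equalityI subsetI)
  show "inj_on f {n. \<forall>m<n. f m \<noteq> f n}"
    by (auto simp: inj_on_def) (metis nat_neq_iff)
next
  fix y assume "y \<in> range f"
  then have "\<exists>n. f n = y"
    by auto
  then obtain n where "f n = y" "\<forall>m<n. f m \<noteq> y"
    using exists_least_iff[of "\<lambda>n. f n = y"] by auto
  then show "y \<in> f ` {n. \<forall>m<n. f m \<noteq> f n}"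
    by auto
qed auto

lemma isomorphic_models_replace_observables:
  assumes "bij_betw \<phi> S T" "inj_on \<psi> A" "\<And>\<alpha> s. \<alpha> \<in> A \<Longrightarrow> s \<in> S \<Longrightarrow> \<alpha> s = \<psi> \<alpha> (\<phi> s)"
  shows "isomorphic_models (S, A) (T, \<psi> ` A)"
  using assms unfolding isomorphic_models_def by (auto simp: bij_betw_def)

theorem theorem3:
  fixes S :: "nat set" and A :: "(nat \<rightharpoonup> nat) set"
  assumes "recursively_enumerable S"
    and "\<And>\<alpha>. \<alpha> \<in> A \<Longrightarrow> partial_recursive \<alpha> \<and> S \<subseteq> dom \<alpha>"
  shows "\<exists>M. computable_model M \<and> isomorphic_models (S, A) M"
proof -
  have "countable A"
    using countable_partial_recursive by (rule countable_subset[rotated]) (use assms(2) in auto)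
  then obtain e :: "(nat \<rightharpoonup> nat) \<Rightarrow> nat" where e: "inj_on e A"
    by (auto simp: countable_def)
  show ?thesis
  proof (cases "S = {}")
    case True
    \<comment> \<open>Without states only the number of observables matters, so constant functions
      with distinct values suffice.\<close>
    let ?\<psi> = "\<lambda>\<alpha> n. Some (e \<alpha>)"
    have "computable_model ({}, ?\<psi> ` A)"
      by (auto simp: computable_model_def recursive_set_def total_recursive_iff_recursive_n
          recursive_n_const)
    moreover have "inj_on ?\<psi> A"
      using e by (auto simp: inj_on_def fun_eq_iff)
    then have "isomorphic_models (S, A) ({}, ?\<psi> ` A)"
      using True by (intro isomorphic_models_replace_observables) auto
    ultimately show ?thesis
      by blast
  next
    case False
    then obtain f0 where f0: "total_recursive f0" "S = ran f0"
      using assms(1) by (auto simp: recursively_enumerable_def)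
    define f where "f n = the (f0 n)" for n
    have f0_eq: "f0 = (\<lambda>n. Some (f n))"
    proof
      fix n show "f0 n = Some (f n)"
        using f0(1) by (auto simp: f_def total_recursive_def dom_def set_eq_iff)
    qed
    \<comment> \<open>Truncated subtraction gives \<open>h 0 = h 1 = f 0\<close>, while the range
      stays that of \<open>f\<close>.\<close>
    define h where "h n = f (n - 1)" for n
    have h: "total_recursive (\<lambda>n. Some (h n))"
      using f0(1) recursive_n_comp1[OF _ recursive_n_pred, of f]
      by (simp add: f0_eq total_recursive_iff_recursive_n h_def)
    have "f n = h (Suc n)" for n
      by (simp add: h_def)
    then have "range f = range h"
      unfolding h_def by (metis (no_types, lifting) image_subset_iff rangeI subsetI subset_antisym)
    moreover have "S = range f"
      using f0(2) by (auto simp: f0_eq ran_def)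
    ultimately have S: "S = range h"
      by simp
    define T where "T = {n. \<forall>m<n. h m \<noteq> h n}"
    have "1 \<notin> T"
      by (auto simp: T_def h_def)
    have T: "recursive_set T"
      unfolding T_def using h by (rule recursive_set_first_occurrences)
    have bij: "bij_betw h T S"
      unfolding T_def S by (rule bij_betw_first_occurrences)
    define \<psi> where "\<psi> \<alpha> n = Some (if n \<in> T then the (\<alpha> (h n)) else e \<alpha>)" for \<alpha> n
    have "total_recursive (\<psi> \<alpha>)" if "\<alpha> \<in> A" for \<alpha>
    proof -
      let ?c = "\<lambda>n. if n \<in> T then 1 else 0 :: nat"
      \<comment> \<open>The case distinction needs both branches total: \<open>\<alpha>\<close> is
        defined at \<open>h n\<close> even for \<open>n\<close> outside \<open>T\<close>, because
        \<open>h\<close> maps into \<open>S\<close>.\<close>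
      have "recursive_n 1 (\<lambda>xs. if ?c (xs ! 0) = 0 then e \<alpha> else the (\<alpha> (h (xs ! 0))))"
        using T total_recursive_partial_comp[OF _ h] assms(2)[OF that] S
        unfolding recursive_set_def total_recursive_iff_recursive_n
        by (intro recursive_n_if_zero recursive_n_const) auto
      then have "recursive_n 1 (\<lambda>xs. if xs ! 0 \<in> T then the (\<alpha> (h (xs ! 0))) else e \<alpha>)"
        by (rule recursive_n_cong) auto
      then show ?thesis
        unfolding \<psi>_def total_recursive_iff_recursive_n .
    qed
    with T have "computable_model (T, \<psi> ` A)"
      by (auto simp: computable_model_def)
    moreover have "isomorphic_models (S, A) (T, \<psi> ` A)"
    proof (rule isomorphic_models_replace_observables)
      show "bij_betw (inv_into T h) S T"
        using bij by (rule bij_betw_inv_into)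
      show "inj_on \<psi> A"
      proof (rule inj_onI)
        fix \<alpha> \<beta> assume "\<alpha> \<in> A" "\<beta> \<in> A" "\<psi> \<alpha> = \<psi> \<beta>"
        \<comment> \<open>At 1, outside \<open>T\<close>, the new observables show their
          indices.\<close>
        then have "\<psi> \<alpha> 1 = \<psi> \<beta> 1"
          by simp
        then have "e \<alpha> = e \<beta>"
          using \<open>1 \<notin> T\<close> by (simp add: \<psi>_def)
        with e show "\<alpha> = \<beta>"
          using \<open>\<alpha> \<in> A\<close> \<open>\<beta> \<in> A\<close> by (rule inj_onD)
      qed
      fix \<alpha> s assume "\<alpha> \<in> A" "s \<in> S"
      then have "inv_into T h s \<in> T" "h (inv_into T h s) = s" "s \<in> dom \<alpha>"
        using bij assms(2) by (auto simp: bij_betw_def inv_into_into f_inv_into_f)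
      then show "\<alpha> s = \<psi> \<alpha> (inv_into T h s)"
        by (auto simp: \<psi>_def)
    qed
    ultimately show ?thesis
      by blast
  qed
qed

end
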